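(* Let $f:\mathbb{R}^d\to\mathbb{R}$ be differentiable, convex and symmetrically $(L_0,L_1)$-smooth with $L_0>0$, $L_1>0$, and let $x^*\in\arg\min_{x\in\mathbb{R}^d} f(x)$. Let $\nu$ be the real number with $\nu=e^{-\nu}$, let $x^0\in\mathbb{R}^d$, and let $(x^k)_{k\ge0}$ be the iterates of Gradient Descent with Polyak Stepsizes (GD-PS), $$x^{k+1}=x^k-\frac{f(x^k)-f(x^* )}{\|\nabla f(x^k)\|^2}\nabla f(x^k).$$ Then for every $k\ge0$ $$\|\nabla f(x^k)\|\ge\frac{L_0}{L_1}\ \Longrightarrow\ \|x^{k+1}-x^*\|^2\le\|x^k-x^*\|^2-\frac{\nu^2}{16L_1^2}.$$ Moreover, for every integer $N\ge0$, $$\frac{4L_0}{\nu}\|x^{N+1}-x^*\|^2+\sum_{k\in\{0,1,\ldots,N\}\setminus\mathcal{T}}\big(f(x^k)-f(x^* )\big)\le\frac{4L_0}{\nu}\|x^0-x^*\|^2-\frac{\nu L_0T}{4L_1^2},$$ where $\mathcal{T}:=\{k\in\{0,1,\ldots,N\}\mid\|\nabla f(x^k)\|\ge\frac{L_0}{L_1}\}$ and $T:=|\mathcal{T}|$; and if $N>T-1$, then $$f(\hat x^N)-f(x^* )\le\frac{4L_0\|x^0-x^*\|^2}{\nu(N-T+1)}-\frac{\nu L_0T}{4L_1^2(N-T+1)},$$ where $\hat x^N\in\{x^0,\ldots,x^N\}$ is such that $f(\hat x^N)=\min_{x\in\{x^0,\ldots,x^N\}}f(x)$. In particular, for $N>\frac{16L_1^2\|x^0-x^*\|^2}{\nu^2}-1$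 the inequality $N>T-1$ is guaranteed and $$f(\hat x^N)-f(x^* )\le\frac{4L_0\|x^0-x^*\|^2}{\nu(N+1)}.$$
   Context: $\|\cdot\|$ is the Euclidean norm. A differentiable $f:\mathbb{R}^d\to\mathbb{R}$ is convex if $f(y)\ge f(x)+\langle\nabla f(x),y-x\rangle$ for all $x,y$. It is symmetrically $(L_0,L_1)$-smooth if for all $x,y\in\mathbb{R}^d$ $$\|\nabla f(x)-\nabla f(y)\|\le\Big(L_0+L_1\sup_{u\in[x,y]}\|\nabla f(u)\|\Big)\|x-y\|,$$ where $[x,y]$ is the line segment between $x$ and $y$. Convention: if $\nabla f(x^k)=0$ (so $x^k$ is a minimizer), then the GD-PS step is $x^{k+1}=x^k$. *)

theory Defs
  imports "HOL-Analysis.Analysis"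
begin

definition grad :: "('a::euclidean_space \<Rightarrow> real) \<Rightarrow> 'a \<Rightarrow> 'a" where
  "grad f x = (THE D. GDERIV f x :> D)"

lemma GDERIV_unique:
  fixes f :: "'a::euclidean_space \<Rightarrow> real"
  assumes "GDERIV f x :> D" "GDERIV f x :> E"
  shows "D = E"
proof -
  have "(\<lambda>h. inner h D) = (\<lambda>h. inner h E)"
    using assms unfolding gderiv_def by (rule has_derivative_unique)
  then have "inner h D = inner h E" for h
    by (rule fun_cong)
  then show ?thesis
    using vector_eq_ldot by blast
qed

lemma grad_eqI:
  fixes f :: "'a::euclidean_space \<Rightarrow> real"
  assumes "GDERIV f x :> D"
  shows "grad f x = D"
  unfolding grad_def using assms by (blast intro: the_equality GDERIV_unique)

lemma differentiable_imp_GDERIV_grad: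
  fixes f :: "'a::euclidean_space \<Rightarrow> real"
  assumes "f differentiable (at x)"
  shows "GDERIV f x :> grad f x"
proof -
  obtain f' where f': "(f has_derivative f') (at x)"
    using assms unfolding differentiable_def by blast
  then have lin: "linear f'"
    by (rule has_derivative_linear)
  have "f' = (\<lambda>h. inner h (adjoint f' 1))"
    using adjoint_works[OF lin, of _ 1] by auto
  then have "GDERIV f x :> adjoint f' 1"
    using f' unfolding gderiv_def by simp
  then show ?thesis
    using grad_eqI by metis
qed

text \<open>First-order convexity of a differentiable function; the lemma below shows
  agreement with \<^const>\<open>convex_on\<close>.\<close>

definition grad_convex :: "('a::euclidean_space \<Rightarrow> real) \<Rightarrow> bool" where
  "grad_convex f \<longleftrightarrow> (\<forall>x y. f y \<ge> f x + inner (grad f x) (y - x))"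

lemma grad_convex_iff_convex_on:
  fixes f :: "'a::euclidean_space \<Rightarrow> real"
  assumes diff: "\<And>x. f differentiable (at x)"
  shows "grad_convex f \<longleftrightarrow> convex_on UNIV f"
proof
  assume gc: "grad_convex f"
  show "convex_on UNIV f"
    unfolding convex_on_def
  proof (intro conjI ballI allI impI)
    fix x y :: 'a and u v :: real
    assume uv: "u \<ge> 0" "v \<ge> 0" "u + v = 1"
    define z where "z = u *\<^sub>R x + v *\<^sub>R y"
    have bx: "f z + inner (grad f z) (x - z) \<le> f x"
      and by': "f z + inner (grad f z) (y - z) \<le> f y"
      using gc unfolding grad_convex_def by auto
    have "u *\<^sub>R (x - z) + v *\<^sub>R (y - z) = z - (u + v) *\<^sub>R z"
      unfolding z_def by (simp add: algebra_simps)
    then have "u *\<^sub>R (x - z) + v *\<^sub>R (y - z) = 0"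
      using uv by simp
    then have i0: "u * inner (grad f z) (x - z) + v * inner (grad f z) (y - z) = 0"
      by (metis inner_add_right inner_scaleR_right inner_zero_right)
    have "u * (f z + inner (grad f z) (x - z)) + v * (f z + inner (grad f z) (y - z))
        \<le> u * f x + v * f y"
      using bx by' uv by (intro add_mono mult_left_mono) auto
    moreover have "u * (f z + inner (grad f z) (x - z)) + v * (f z + inner (grad f z) (y - z))
        = (u + v) * f z"
      using i0 by (simp add: algebra_simps)
    ultimately show "f (u *\<^sub>R x + v *\<^sub>R y) \<le> u * f x + v * f y"
      using uv by (simp add: z_def)
  qed simp
next
  assume cv: "convex_on UNIV f"
  show "grad_convex f"
    unfolding grad_convex_def
  proof (intro allI)
    fix x y :: 'a
    define g where "g t = f (x + t *\<^sub>R (y - x))" for t :: real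
    have "convex_on UNIV g"
      unfolding convex_on_def
    proof (intro conjI ballI allI impI)
      fix s t u v :: real
      assume uv: "u \<ge> 0" "v \<ge> 0" "u + v = 1"
      have "x + (u * s + v * t) *\<^sub>R (y - x)
          = (u + v) *\<^sub>R x + (u * s + v * t) *\<^sub>R (y - x)"
        using uv by simp
      also have "\<dots> = u *\<^sub>R (x + s *\<^sub>R (y - x)) + v *\<^sub>R (x + t *\<^sub>R (y - x))"
        by (simp add: algebra_simps)
      finally show "g (u *\<^sub>R s + v *\<^sub>R t) \<le> u * g s + v * g t"
        using cv uv unfolding convex_on_def g_def by simp
    qed simp
    moreover have "(g has_real_derivative inner (grad f x) (y - x)) (at 0 within UNIV)"
    proof -
      have "((\<lambda>t. x + t *\<^sub>R (y - x)) has_derivative (\<lambda>t. t *\<^sub>R (y - x))) (at (0::real))"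
        by (auto intro!: derivative_eq_intros)
      moreover have "(f has_derivative (\<lambda>h. inner h (grad f x)))
          (at (x + (0::real) *\<^sub>R (y - x)))"
        using differentiable_imp_GDERIV_grad[OF diff, of x] by (simp add: gderiv_def)
      ultimately have "((\<lambda>t. f (x + t *\<^sub>R (y - x))) has_derivative
          (\<lambda>t. inner (t *\<^sub>R (y - x)) (grad f x))) (at (0::real))"
        by (rule has_derivative_compose)
      then show ?thesis
        unfolding g_def has_field_derivative_def
        by (simp add: inner_commute mult_commute_abs)
    qed
    ultimately have "g 1 - g 0 \<ge> inner (grad f x) (y - x) * (1 - 0)"
      by (intro convex_on_imp_above_tangent) auto
    then show "f y \<ge> f x + inner (grad f x) (y - x)"
      by (simp add: g_def)
  qed
qed

text \<open>The supremum is taken in \<^typ>\<open>ereal\<close>, because \<^const>\<open>Sup\<close> on \<^typ>\<open>real\<close> is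
  unspecified for sets that are not bounded above.\<close>

definition sym_L0_L1_smooth :: "real \<Rightarrow> real \<Rightarrow> ('a::euclidean_space \<Rightarrow> real) \<Rightarrow> bool" where
  "sym_L0_L1_smooth L0 L1 f \<longleftrightarrow>
     (\<forall>x y. ereal (norm (grad f x - grad f y)) \<le>
        (ereal L0 + ereal L1 * (SUP u\<in>closed_segment x y. ereal (norm (grad f u))))
          * ereal (norm (x - y)))"

definition gdps_step :: "('a::euclidean_space \<Rightarrow> real) \<Rightarrow> 'a \<Rightarrow> 'a \<Rightarrow> 'a" where
  "gdps_step f xstar x =
     (if grad f x = 0 then x
      else x - ((f x - f xstar) / (norm (grad f x))\<^sup>2) *\<^sub>R grad f x)"

definition large_grad_steps ::
  "real \<Rightarrow> real \<Rightarrow> ('a::euclidean_space \<Rightarrow> real) \<Rightarrow> (nat \<Rightarrow> 'a) \<Rightarrow> nat \<Rightarrow> nat set" where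
  "large_grad_steps L0 L1 f x N = {k \<in> {0..N}. norm (grad f (x k)) \<ge> L0 / L1}"

end

theory Submission
  imports Defs
begin

text \<open>Put \<open>q = L0 + L1 \<parallel>\<nabla>f\<parallel>\<close>. Subdividing \<open>[x, y]\<close> into \<open>n\<close> pieces and letting \<open>n\<close> tend to
  infinity, smoothness gives \<open>q y \<le> q x exp (L1 \<parallel>x - y\<parallel>)\<close>. So \<open>\<nabla>f\<close> is Lipschitz relative to \<open>x\<close>, with
  constant \<open>q x / \<nu>\<close>, within distance \<open>\<nu> / L1\<close> of \<open>x\<close>, and a gradient step of size \<open>\<nu> / q x\<close> shows
  \<open>f x - f x* \<ge> \<nu> \<parallel>\<nabla>f x\<parallel>\<^sup>2 / (2 q x)\<close>. A Polyak step decreases \<open>\<parallel>x - x*\<parallel>\<^sup>2\<close> by at least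
  \<open>(f x - f x*)\<^sup>2 / \<parallel>\<nabla>f x\<parallel>\<^sup>2\<close>, which is at least \<open>\<nu>\<^sup>2 / (16 L1\<^sup>2)\<close> when \<open>\<parallel>\<nabla>f x\<parallel> \<ge> L0 / L1\<close> and at
  least \<open>\<nu> (f x - f x*) / (4 L0)\<close> otherwise.\<close>

section \<open>Gradient bounds on segments\<close>

lemma grad_convexD: "grad_convex f \<Longrightarrow> f x + inner (grad f x) (y - x) \<le> f y"
  by (simp add: grad_convex_def)

text \<open>Makes the extended-real supremum in the smoothness condition finite without assuming a
  continuous gradient. By convexity, moving from \<open>u\<close> one unit along the gradient raises
  \<open>f\<close> by at least \<open>norm (grad f u)\<close>, and \<open>f\<close> is bounded on
  the compact unit neighbourhood \<open>?K\<close> of the segment.\<close>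

lemma bdd_above_norm_grad_segment:
  fixes f :: "'a::euclidean_space \<Rightarrow> real"
  assumes diff: "\<And>z. f differentiable (at z)" and conv: "grad_convex f"
  shows "bdd_above ((\<lambda>u. norm (grad f u)) ` closed_segment x y)"
proof -
  let ?K = "{u + v |u v. u \<in> closed_segment x y \<and> v \<in> cball (0::'a) 1}"
  have "continuous_on ?K f"
    by (meson diff continuous_at_imp_continuous_on differentiable_imp_continuous_within)
  then have "bounded (f ` ?K)"
    by (intro compact_imp_bounded compact_continuous_image compact_sums) auto
  then obtain B where B: "\<And>z. z \<in> ?K \<Longrightarrow> \<bar>f z\<bar> \<le> B"
    unfolding bounded_iff by auto
  have "norm (grad f u) \<le> 2 * B" if u: "u \<in> closed_segment x y" for u
  proof -
    let ?g = "grad f u"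
    have "norm (sgn ?g) \<le> 1"
      by (simp add: norm_sgn)
    then have "\<bar>f (u + sgn ?g)\<bar> \<le> B"
      using u by (intro B) (auto simp: dist_norm)
    moreover have "\<bar>f (u + 0)\<bar> \<le> B"
      by (rule B, rule CollectI, rule exI[of _ u], rule exI[of _ 0]) (use u in auto)
    moreover have "inner ?g (sgn ?g) = norm ?g"
      by (simp add: sgn_div_norm norm_eq_sqrt_inner real_div_sqrt field_simps)
    ultimately show ?thesis
      using grad_convexD[OF conv, of u "u + sgn ?g"] by simp
  qed
  then show ?thesis
    by (auto simp: bdd_above_def)
qed

text \<open>Leaves \<open>ereal\<close>: since \<open>L1\<close> is nonnegative, the right-hand side
  is monotone in the supremum, so any real upper bound \<open>M\<close> can replace it.\<close>

lemma sym_L0_L1_smooth_norm_grad_diff_le: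
  fixes f :: "'a::euclidean_space \<Rightarrow> real"
  assumes smooth: "sym_L0_L1_smooth L0 L1 f" and L1: "L1 \<ge> 0"
    and M: "\<And>u. u \<in> closed_segment x y \<Longrightarrow> norm (grad f u) \<le> M"
  shows "norm (grad f x - grad f y) \<le> (L0 + L1 * M) * norm (x - y)"
proof -
  let ?S = "SUP u\<in>closed_segment x y. ereal (norm (grad f u))"
  have "?S \<le> ereal M"
    using M by (auto intro: SUP_least)
  then have "(ereal L0 + ereal L1 * ?S) * ereal (norm (x - y))
      \<le> (ereal L0 + ereal L1 * ereal M) * ereal (norm (x - y))"
    using L1 by (intro ereal_mult_right_mono add_left_mono ereal_mult_left_mono) auto
  then have "ereal (norm (grad f x - grad f y)) \<le> (ereal L0 + ereal L1 * ereal M) * ereal (norm (x - y))"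
    using smooth order_trans unfolding sym_L0_L1_smooth_def by blast
  then show ?thesis
    by simp
qed

section \<open>Exponential control of the gradient along segments\<close>

locale convex_L0_L1_smooth =
  fixes f :: "'a::euclidean_space \<Rightarrow> real" and L0 L1 :: real
  assumes diff: "\<And>z. f differentiable (at z)"
    and conv: "grad_convex f"
    and smooth: "sym_L0_L1_smooth L0 L1 f"
    and L0_pos: "L0 > 0"
    and L1_pos: "L1 > 0"
begin

text \<open>The quantity \<open>q\<close> of the overview. Including \<open>L0\<close> turns the
  affine smoothness bound into a purely multiplicative one, which can be iterated.\<close>

definition growth :: "'a \<Rightarrow> real" where
  "growth x = L0 + L1 * norm (grad f x)"

lemma growth_pos: "growth x > 0"
  unfolding growth_def using L0_pos L1_pos by (simp add: add_pos_nonneg)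

text \<open>The supremum \<open>M\<close> of the gradient norm over the segment is bounded by a term
  that contains \<open>M\<close> again with factor \<open>L1 * norm (x - y)\<close>. As this factor
  is below 1, that term can be absorbed on the left.\<close>

lemma growth_short_segment:
  assumes "L1 * norm (x - y) < 1"
  shows "(1 - L1 * norm (x - y)) * growth y \<le> growth x"
proof -
  let ?I = "(\<lambda>u. norm (grad f u)) ` closed_segment x y"
  define M where "M = Sup ?I"
  note bdd = bdd_above_norm_grad_segment[OF diff conv, of x y]
  have le_M: "norm (grad f u) \<le> M" if "u \<in> closed_segment x y" for u
    unfolding M_def using that by (intro cSup_upper bdd) auto
  have "0 \<le> M"
    using le_M[of x] norm_ge_zero[of "grad f x"] by (meson ends_in_segment order_trans)
  then have q0: "0 \<le> L0 + L1 * M"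
    using L0_pos L1_pos by simp
  have "M \<le> norm (grad f x) + (L0 + L1 * M) * norm (x - y)"
    unfolding M_def
  proof (rule cSup_least)
    fix a assume "a \<in> ?I"
    then obtain u where u: "u \<in> closed_segment x y" and a: "a = norm (grad f u)"
      by auto
    \<comment> \<open>Smoothness is applied on the subsegment from \<open>x\<close> to
      \<open>u\<close>, where \<open>M\<close> is still an upper bound.\<close>
    have "closed_segment x u \<subseteq> closed_segment x y"
      using u by (simp add: subset_closed_segment)
    then have "norm (grad f x - grad f u) \<le> (L0 + L1 * M) * norm (x - u)"
      using L1_pos by (intro sym_L0_L1_smooth_norm_grad_diff_le[OF smooth] le_M) auto
    also have "\<dots> \<le> (L0 + L1 * M) * norm (x - y)"
      using segment_bound1[OF u] q0 by (intro mult_left_mono) (auto simp: norm_minus_commute)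
    finally show "a \<le> norm (grad f x) + (L0 + L1 * Sup ?I) * norm (x - y)"
      using norm_triangle_ineq2[of "grad f u" "grad f x"] a
      by (simp add: norm_minus_commute M_def)
  qed auto
  then have "L1 * M \<le> L1 * (norm (grad f x) + (L0 + L1 * M) * norm (x - y))"
    using L1_pos by simp
  then have "(1 - L1 * norm (x - y)) * (L0 + L1 * M) \<le> growth x"
    by (simp add: growth_def algebra_simps)
  moreover have "growth y \<le> L0 + L1 * M"
    unfolding growth_def using le_M[of y] L1_pos by simp
  then have "(1 - L1 * norm (x - y)) * growth y \<le> (1 - L1 * norm (x - y)) * (L0 + L1 * M)"
    using assms by (intro mult_left_mono) auto
  ultimately show ?thesis
    by linarith
qed

text \<open>Chains \<open>growth_short_segment\<close> over \<open>n\<close> equal pieces, each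
  short enough although the whole segment need not be.\<close>

lemma growth_subdivision:
  assumes n: "n > 0" and c: "L1 * norm (x - y) < real n"
  shows "(1 - L1 * norm (x - y) / real n) ^ n * growth y \<le> growth x"
proof -
  define p where "p i = x + (real i / real n) *\<^sub>R (y - x)" for i
  define c where "c = 1 - L1 * norm (x - y) / real n"
  have c0: "c > 0"
    using n c by (simp add: c_def)
  have step: "c * growth (p (Suc i)) \<le> growth (p i)" for i
  proof -
    have "p i - p (Suc i) = (1 / real n) *\<^sub>R (x - y)"
      by (simp add: p_def algebra_simps add_divide_distrib)
    then have "c = 1 - L1 * norm (p i - p (Suc i))"
      by (simp add: c_def)
    then show ?thesis
      using growth_short_segment c0 by simp
  qed
  have "c ^ i * growth (p i) \<le> growth x" for i
  proof (induction i)
    case 0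
    then show ?case by (simp add: p_def)
  next
    case (Suc i)
    have "c ^ Suc i * growth (p (Suc i)) = c ^ i * (c * growth (p (Suc i)))"
      by simp
    also have "\<dots> \<le> c ^ i * growth (p i)"
      using step c0 by (intro mult_left_mono) auto
    finally show ?case
      using Suc by linarith
  qed
  from this[of n] show ?thesis
    using n by (simp add: p_def c_def)
qed

text \<open>A discrete substitute for a Gronwall argument, since the gradient is not assumed
  differentiable.\<close>

lemma growth_exp: "growth y \<le> growth x * exp (L1 * norm (x - y))"
proof -
  define r where "r = L1 * norm (x - y)"
  have "(\<lambda>n. (1 + (- r) / real n) ^ n * growth y) \<longlonglongrightarrow> exp (- r) * growth y"
    by (intro tendsto_intros tendsto_exp_limit_sequentially)
  moreover have "\<forall>\<^sub>F n in sequentially. (1 + (- r) / real n) ^ n * growth y \<le> growth x"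
    using eventually_gt_at_top[of "max 0 (nat \<lceil>r\<rceil>)"]
  proof eventually_elim
    case (elim n)
    then have "n > 0" "r < real n"
      by linarith+
    then show ?case
      using growth_subdivision[of n x y] by (simp add: r_def)
  qed
  ultimately have "exp (- r) * growth y \<le> growth x"
    by (intro tendsto_upperbound) auto
  then show ?thesis
    by (simp add: r_def exp_minus field_simps)
qed

lemma norm_grad_diff_le_exp:
  assumes "L1 * norm (x - y) \<le> r"
  shows "norm (grad f x - grad f y) \<le> growth x * exp r * norm (x - y)"
proof -
  \<comment> \<open>Chosen so that \<open>L0 + L1 * ?M\<close> equals
    \<open>growth x * exp r\<close>.\<close>
  let ?M = "(growth x * exp r - L0) / L1"
  have "norm (grad f u) \<le> ?M" if u: "u \<in> closed_segment x y" for u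
  proof -
    have "L1 * norm (x - u) \<le> L1 * norm (x - y)"
      using segment_bound1[OF u] L1_pos by (simp add: norm_minus_commute)
    then have "growth x * exp (L1 * norm (x - u)) \<le> growth x * exp r"
      using assms growth_pos[of x] by simp
    then have "growth u \<le> growth x * exp r"
      using growth_exp[of u x] by linarith
    then show ?thesis
      using L1_pos by (simp add: growth_def field_simps)
  qed
  from sym_L0_L1_smooth_norm_grad_diff_le[OF smooth _ this] show ?thesis
    using L1_pos by simp
qed

section \<open>Local descent and the suboptimality bound\<close>

lemma descent:
  assumes r: "L1 * norm (y - x) \<le> r"
  shows "f y \<le> f x + inner (grad f x) (y - x) + growth x * exp r / 2 * (norm (y - x))\<^sup>2"
proof -
  define C where "C = growth x * exp r * (norm (y - x))\<^sup>2"
  \<comment> \<open>The gap between \<open>f\<close> on the segment and its quadratic upper model,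
    up to a constant. The claim is \<open>\<psi> 1 \<le> \<psi> 0\<close>, so a nonpositive
    derivative suffices and no integral is taken.\<close>
  define \<psi> where "\<psi> t = f (x + t *\<^sub>R (y - x)) - t * inner (grad f x) (y - x) - C * t\<^sup>2 / 2" for t
  have "\<psi> 1 \<le> \<psi> 0"
  proof (rule DERIV_nonpos_imp_nonincreasing[of 0 1])
    fix t :: real assume t: "0 \<le> t" "t \<le> 1"
    let ?z = "x + t *\<^sub>R (y - x)"
    have "((\<lambda>t. x + t *\<^sub>R (y - x)) has_derivative (\<lambda>t. t *\<^sub>R (y - x))) (at t)"
      by (auto intro!: derivative_eq_intros)
    moreover have "(f has_derivative (\<lambda>h. inner h (grad f ?z))) (at ?z)"
      using differentiable_imp_GDERIV_grad[OF diff] by (simp add: gderiv_def)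
    ultimately have "((\<lambda>t. f (x + t *\<^sub>R (y - x))) has_derivative
        (\<lambda>s. inner (s *\<^sub>R (y - x)) (grad f ?z))) (at t)"
      by (rule has_derivative_compose)
    then have f': "((\<lambda>t. f (x + t *\<^sub>R (y - x))) has_real_derivative inner (grad f ?z) (y - x)) (at t)"
      unfolding has_field_derivative_def by (simp add: inner_commute mult_commute_abs)
    have "(\<psi> has_real_derivative
        inner (grad f ?z) (y - x) - inner (grad f x) (y - x) - C * t) (at t)"
      unfolding \<psi>_def by (rule derivative_eq_intros f' refl | simp)+
    moreover have "inner (grad f ?z) (y - x) - inner (grad f x) (y - x) \<le> C * t"
    proof -
      have nz: "norm (x - ?z) = t * norm (y - x)"
        using t by simp
      have "L1 * norm (x - ?z) \<le> r"
        using r t L1_pos mult_left_le_one_le[of "L1 * norm (y - x)" t] unfolding nz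
        by (simp only: mult.left_commute) (simp add: order_trans[OF _ r])
      then have "norm (grad f x - grad f ?z) \<le> growth x * exp r * (t * norm (y - x))"
        using norm_grad_diff_le_exp nz by metis
      then have "norm (grad f ?z - grad f x) * norm (y - x)
          \<le> growth x * exp r * (t * norm (y - x)) * norm (y - x)"
        by (intro mult_right_mono) (simp_all add: norm_minus_commute)
      moreover have "inner (grad f ?z - grad f x) (y - x) \<le> norm (grad f ?z - grad f x) * norm (y - x)"
        by (rule norm_cauchy_schwarz)
      ultimately show ?thesis
        by (simp add: C_def inner_diff_left power2_eq_square mult_ac)
    qed
    ultimately show "\<exists>l. (\<psi> has_real_derivative l) (at t) \<and> l \<le> 0"
      by force
  qed simp
  then show ?thesis
    by (simp add: \<psi>_def C_def)
qed

lemma suboptimality_ge_grad: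
  assumes nu: "\<nu> = exp (- \<nu>)" and min: "\<And>z. f xstar \<le> f z"
  shows "\<nu> * (norm (grad f x))\<^sup>2 \<le> 2 * growth x * (f x - f xstar)"
proof -
  define g where "g = grad f x"
  define q where "q = growth x"
  define y where "y = x - (\<nu> / q) *\<^sub>R g"
  have nu0: "\<nu> > 0"
    using nu exp_gt_zero[of "- \<nu>"] by linarith
  \<comment> \<open>This is what singles out \<nu>: the quadratic constant
    \<open>q * exp \<nu>\<close> becomes \<open>q / \<nu>\<close>, the inverse of the step size, so
    the quadratic term gives back exactly half of the linear gain.\<close>
  have enu: "\<nu> * exp \<nu> = 1"
    by (subst nu) (simp flip: exp_add)
  have q0: "q > 0"
    by (simp add: q_def growth_pos)
  have d: "norm (y - x) = \<nu> / q * norm g"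
    using nu0 q0 by (simp add: y_def)
  \<comment> \<open>Because \<open>q\<close> contains \<open>L1 * norm g\<close>, the step of size
    \<open>\<nu> / q\<close> stays in the region where \<open>descent\<close> applies with
    \<open>r = \<nu>\<close>.\<close>
  have "L1 * norm g \<le> q"
    using L0_pos by (simp add: q_def growth_def g_def)
  then have "L1 * norm (y - x) \<le> \<nu>"
    using nu0 q0 by (simp add: d field_simps)
  then have "f y \<le> f x + inner g (y - x) + q * exp \<nu> / 2 * (norm (y - x))\<^sup>2"
    unfolding g_def q_def by (rule descent)
  moreover have "inner g (y - x) = - (\<nu> / q * (norm g)\<^sup>2)"
    by (simp add: y_def power2_norm_eq_inner)
  moreover have "q * exp \<nu> / 2 * (norm (y - x))\<^sup>2 = (\<nu> * exp \<nu>) * (\<nu> / q * (norm g)\<^sup>2) / 2"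
    using q0 by (simp add: d power2_eq_square mult_ac)
  ultimately have "f xstar \<le> f x - \<nu> / q * (norm g)\<^sup>2 / 2"
    using min[of y] by (simp add: enu)
  then show ?thesis
    using q0 by (simp add: g_def[symmetric] q_def[symmetric] field_simps)
qed

section \<open>Distance decrease in one Polyak step\<close>

lemma gdps_step_dist:
  assumes min: "\<And>z. f xstar \<le> f z" and g: "grad f x \<noteq> 0"
  shows "(norm (gdps_step f xstar x - xstar))\<^sup>2
    \<le> (norm (x - xstar))\<^sup>2 - (f x - f xstar)\<^sup>2 / (norm (grad f x))\<^sup>2"
proof -
  \<comment> \<open>Convexity bounds the new squared distance by a quadratic in the step size; the
    Polyak value \<open>s\<close> is its minimiser.\<close>
  define s where "s = (f x - f xstar) / (norm (grad f x))\<^sup>2"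
  have n0: "(norm (grad f x))\<^sup>2 > 0"
    using g by simp
  have "s \<ge> 0"
    using min[of x] by (simp add: s_def)
  have "f x - f xstar \<le> inner (grad f x) (x - xstar)"
    using grad_convexD[OF conv, of x xstar] by (simp add: inner_diff_right)
  then have "s * (f x - f xstar) \<le> s * inner (grad f x) (x - xstar)"
    using \<open>s \<ge> 0\<close> by (rule mult_left_mono)
  moreover have "gdps_step f xstar x - xstar = (x - xstar) - s *\<^sub>R grad f x"
    using g by (simp add: gdps_step_def s_def)
  then have "(norm (gdps_step f xstar x - xstar))\<^sup>2
      = (norm (x - xstar))\<^sup>2 - 2 * (s * inner (grad f x) (x - xstar)) + s\<^sup>2 * (norm (grad f x))\<^sup>2"
    by (simp only:) (simp add: power2_norm_eq_inner inner_diff_left inner_diff_right inner_commute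
        power2_eq_square[of s] algebra_simps)
  moreover have "s\<^sup>2 * (norm (grad f x))\<^sup>2 = s * (f x - f xstar)"
    using n0 by (simp add: s_def power2_eq_square)
  moreover have "s * (f x - f xstar) = (f x - f xstar)\<^sup>2 / (norm (grad f x))\<^sup>2"
    by (simp add: s_def power2_eq_square)
  ultimately show ?thesis
    by linarith
qed

text \<open>Here \<open>L1 * n\<close> dominates \<open>L0\<close>, so \<open>growth x\<close> is at
  most \<open>2 * L1 * n\<close>. One factor \<open>n\<close> cancels in the suboptimality bound,
  leaving a constant lower bound on \<open>\<delta> / n\<close>, which is then squared.\<close>

lemma gdps_step_large_grad:
  assumes nu: "\<nu> = exp (- \<nu>)" and min: "\<And>z. f xstar \<le> f z"
    and large: "L0 / L1 \<le> norm (grad f x)"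
  shows "(norm (gdps_step f xstar x - xstar))\<^sup>2 \<le> (norm (x - xstar))\<^sup>2 - \<nu>\<^sup>2 / (16 * L1\<^sup>2)"
proof -
  define n where "n = norm (grad f x)"
  define \<delta> where "\<delta> = f x - f xstar"
  have nu0: "\<nu> > 0"
    using nu exp_gt_zero[of "- \<nu>"] by linarith
  have n0: "n > 0"
    using large L0_pos L1_pos unfolding n_def by (meson divide_pos_pos less_le_trans)
  have "growth x \<le> 2 * (L1 * n)"
    using large L1_pos by (simp add: growth_def n_def field_simps)
  then have "2 * growth x * \<delta> \<le> 2 * (2 * (L1 * n)) * \<delta>"
    using min[of x] by (intro mult_right_mono) (auto simp: \<delta>_def)
  then have "n * (\<nu> * n) \<le> n * (4 * L1 * \<delta>)"
    using suboptimality_ge_grad[OF nu min, of x, folded n_def \<delta>_def]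
    by (simp add: power2_eq_square algebra_simps)
  then have "\<nu> * n \<le> 4 * L1 * \<delta>"
    using n0 by simp
  then have "\<nu> / (4 * L1) \<le> \<delta> / n"
    using n0 L1_pos by (simp add: field_simps)
  then have "(\<nu> / (4 * L1))\<^sup>2 \<le> (\<delta> / n)\<^sup>2"
    using nu0 L1_pos by (intro power_mono) auto
  then show ?thesis
    using gdps_step_dist[OF min, of x] n0
    by (simp add: power_divide power_mult_distrib n_def \<delta>_def)
qed

text \<open>Here \<open>L0\<close> dominates, so \<open>n\<^sup>2\<close> is at most a multiple of
  \<open>\<delta>\<close>. This cancels one factor of \<open>\<delta>\<^sup>2 / n\<^sup>2\<close>
  and leaves a decrease linear in \<open>\<delta>\<close>.\<close>

lemma gdps_step_small_grad:
  assumes nu: "\<nu> = exp (- \<nu>)" and min: "\<And>z. f xstar \<le> f z"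
    and small: "norm (grad f x) \<le> L0 / L1"
  shows "(norm (gdps_step f xstar x - xstar))\<^sup>2
    \<le> (norm (x - xstar))\<^sup>2 - \<nu> * (f x - f xstar) / (4 * L0)"
proof (cases "grad f x = 0")
  \<comment> \<open>A zero gradient makes \<open>x\<close> a minimiser by convexity, so staying put
    satisfies the bound with decrease 0.\<close>
  case True
  then have "f x - f xstar = 0"
    using grad_convexD[OF conv, of x xstar] min[of x] by simp
  then show ?thesis
    using True by (simp add: gdps_step_def)
next
  case False
  define n where "n = norm (grad f x)"
  define \<delta> where "\<delta> = f x - f xstar"
  have n0: "n > 0"
    using False by (simp add: n_def)
  have \<delta>0: "\<delta> \<ge> 0"
    using min[of x] by (simp add: \<delta>_def)
  have "growth x \<le> 2 * L0"
    using small L1_pos by (simp add: growth_def n_def field_simps)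
  then have "2 * growth x * \<delta> \<le> 2 * (2 * L0) * \<delta>"
    using \<delta>0 by (intro mult_right_mono) auto
  then have "\<nu> * n\<^sup>2 \<le> 4 * L0 * \<delta>"
    using suboptimality_ge_grad[OF nu min, of x, folded n_def \<delta>_def] by (simp add: algebra_simps)
  then have "\<nu> * n\<^sup>2 * \<delta> \<le> 4 * L0 * \<delta> * \<delta>"
    using \<delta>0 by (rule mult_right_mono)
  then have "\<nu> * \<delta> / (4 * L0) \<le> \<delta>\<^sup>2 / n\<^sup>2"
    using n0 L0_pos by (simp add: field_simps power2_eq_square)
  then show ?thesis
    using gdps_step_dist[OF min False] by (simp add: n_def \<delta>_def)
qed

section \<open>Telescoping and rates\<close>

lemma gdps_sum:
  assumes nu: "\<nu> = exp (- \<nu>)" and min: "\<And>z. f xstar \<le> f z"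
    and iterates: "\<And>k. x (Suc k) = gdps_step f xstar (x k)"
  shows "4 * L0 / \<nu> * (norm (x (N + 1) - xstar))\<^sup>2
      + (\<Sum>k \<in> {0..N} - large_grad_steps L0 L1 f x N. f (x k) - f xstar)
    \<le> 4 * L0 / \<nu> * (norm (x 0 - xstar))\<^sup>2
      - \<nu> * L0 * real (card (large_grad_steps L0 L1 f x N)) / (4 * L1\<^sup>2)"
proof -
  have nu0: "\<nu> > 0"
    using nu exp_gt_zero[of "- \<nu>"] by linarith
  \<comment> \<open>The weight \<open>4 * L0 / \<nu>\<close> turns the decrease of a small-gradient
    step into exactly \<open>f (x k) - f xstar\<close>, and that of a large-gradient step into the
    constant \<open>a\<close>.\<close>
  define D where "D k = 4 * L0 / \<nu> * (norm (x k - xstar))\<^sup>2" for k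
  define \<T> where "\<T> = large_grad_steps L0 L1 f x N"
  have \<T>: "\<T> \<subseteq> {0..N}" "finite \<T>"
    by (auto simp: \<T>_def large_grad_steps_def)
  define a where "a = \<nu> * L0 / (4 * L1\<^sup>2)"
  have large: "a \<le> D k - D (Suc k)" if "k \<in> \<T>" for k
  proof -
    have "4 * L0 / \<nu> * (norm (x (Suc k) - xstar))\<^sup>2
        \<le> 4 * L0 / \<nu> * ((norm (x k - xstar))\<^sup>2 - \<nu>\<^sup>2 / (16 * L1\<^sup>2))"
      using that gdps_step_large_grad[OF nu min, of "x k"] nu0 L0_pos
      by (intro mult_left_mono) (auto simp: iterates \<T>_def large_grad_steps_def)
    moreover have "4 * L0 / \<nu> * (\<nu>\<^sup>2 / (16 * L1\<^sup>2)) = a"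
      using nu0 L1_pos by (simp add: a_def field_simps power2_eq_square)
    ultimately show ?thesis
      by (simp only: D_def right_diff_distrib)
  qed
  have small: "f (x k) - f xstar \<le> D k - D (Suc k)" if "k \<in> {0..N} - \<T>" for k
  proof -
    have "4 * L0 / \<nu> * (norm (x (Suc k) - xstar))\<^sup>2
        \<le> 4 * L0 / \<nu> * ((norm (x k - xstar))\<^sup>2 - \<nu> * (f (x k) - f xstar) / (4 * L0))"
      using that gdps_step_small_grad[OF nu min, of "x k"] nu0 L0_pos
      by (intro mult_left_mono) (auto simp: iterates \<T>_def large_grad_steps_def)
    moreover have "4 * L0 / \<nu> * (\<nu> * (f (x k) - f xstar) / (4 * L0)) = f (x k) - f xstar"
      using nu0 L0_pos by simp
    ultimately show ?thesis
      by (simp only: D_def right_diff_distrib)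
  qed
  have "(\<Sum>k\<in>{0..N} - \<T>. f (x k) - f xstar) + (\<Sum>k\<in>\<T>. a)
      \<le> (\<Sum>k\<in>{0..N} - \<T>. D k - D (Suc k)) + (\<Sum>k\<in>\<T>. D k - D (Suc k))"
    using small large by (intro add_mono sum_mono) auto
  also have "\<dots> = (\<Sum>k\<in>{0..N}. D k - D (Suc k))"
    using \<T> by (intro sum.subset_diff[symmetric]) auto
  also have "\<dots> = D 0 - D (Suc N)"
    by (induction N) auto
  finally show ?thesis
    by (simp add: D_def \<T>_def[symmetric] a_def algebra_simps)
qed

text \<open>The best value is at most the average over the steps outside
  \<open>large_grad_steps\<close>, whose sum \<open>gdps_sum\<close> controls.\<close>

lemma gdps_best_iterate:
  assumes nu: "\<nu> = exp (- \<nu>)" and min: "\<And>z. f xstar \<le> f z"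
    and iterates: "\<And>k. x (Suc k) = gdps_step f xstar (x k)"
    and T: "T = real (card (large_grad_steps L0 L1 f x N))" "T < real N + 1"
    and best: "\<And>k. k \<le> N \<Longrightarrow> f xhat \<le> f (x k)"
  shows "f xhat - f xstar \<le> (4 * L0 / \<nu> * (norm (x 0 - xstar))\<^sup>2 - \<nu> * L0 * T / (4 * L1\<^sup>2))
    / (real N - T + 1)"
proof -
  let ?\<T> = "large_grad_steps L0 L1 f x N"
  have nu0: "\<nu> > 0"
    using nu exp_gt_zero[of "- \<nu>"] by linarith
  have sub: "?\<T> \<subseteq> {0..N}"
    by (auto simp: large_grad_steps_def)
  \<comment> \<open>Keeps the natural-number subtraction \<open>N + 1 - card ?\<T>\<close> from
    truncating when it is cast to the reals.\<close>
  then have le: "card ?\<T> \<le> N + 1"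
    using card_mono[OF _ sub] by simp
  have "card ({0..N} - ?\<T>) = N + 1 - card ?\<T>"
    using sub by (simp add: card_Diff_subset finite_subset)
  then have card: "real (card ({0..N} - ?\<T>)) = real N - T + 1"
    using le T by simp
  have "(real N - T + 1) * (f xhat - f xstar) = (\<Sum>k\<in>{0..N} - ?\<T>. f xhat - f xstar)"
    by (simp add: card)
  also have "\<dots> \<le> (\<Sum>k\<in>{0..N} - ?\<T>. f (x k) - f xstar)"
    using best by (intro sum_mono) auto
  also have "\<dots> \<le> 4 * L0 / \<nu> * (norm (x 0 - xstar))\<^sup>2 - \<nu> * L0 * T / (4 * L1\<^sup>2)"
  proof -
    have "0 \<le> 4 * L0 / \<nu> * (norm (x (N + 1) - xstar))\<^sup>2"
      using nu0 L0_pos by simp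
    then show ?thesis
      using gdps_sum[where x = x, OF nu min iterates, of N, folded T(1)] by linarith
  qed
  finally show ?thesis
    using T by (simp add: pos_le_divide_eq mult.commute)
qed

text \<open>Each large-gradient step consumes a fixed amount of the initial squared distance;
  dropping the two nonnegative terms of \<open>gdps_sum\<close> bounds their number uniformly in
  \<open>N\<close>.\<close>

lemma card_large_grad_steps_le:
  assumes nu: "\<nu> = exp (- \<nu>)" and min: "\<And>z. f xstar \<le> f z"
    and iterates: "\<And>k. x (Suc k) = gdps_step f xstar (x k)"
  shows "real (card (large_grad_steps L0 L1 f x N)) \<le> 16 * L1\<^sup>2 * (norm (x 0 - xstar))\<^sup>2 / \<nu>\<^sup>2"
proof -
  have nu0: "\<nu> > 0"
    using nu exp_gt_zero[of "- \<nu>"] by linarith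
  let ?T = "real (card (large_grad_steps L0 L1 f x N))"
  have "0 \<le> 4 * L0 / \<nu> * (norm (x (N + 1) - xstar))\<^sup>2"
    using nu0 L0_pos by simp
  moreover have "0 \<le> (\<Sum>k \<in> {0..N} - large_grad_steps L0 L1 f x N. f (x k) - f xstar)"
    using min by (intro sum_nonneg) auto
  ultimately have "\<nu> * L0 * ?T / (4 * L1\<^sup>2) \<le> 4 * L0 / \<nu> * (norm (x 0 - xstar))\<^sup>2"
    using gdps_sum[where x = x, OF nu min iterates, of N] by linarith
  then show ?thesis
    using nu0 L0_pos L1_pos by (simp add: field_simps power2_eq_square)
qed

end

section \<open>Combination of the bounds and the rate for large \<open>N\<close>\<close>

theorem theorem4p1:
  fixes f :: "real ^ 'd \<Rightarrow> real"
    and xstar :: "real ^ 'd"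
    and x :: "nat \<Rightarrow> real ^ 'd"
    and L0 L1 \<nu> :: real
  assumes diff: "\<And>z. f differentiable (at z)"
    and conv: "grad_convex f"
    and smooth: "sym_L0_L1_smooth L0 L1 f"
    and L0_pos: "L0 > 0"
    and L1_pos: "L1 > 0"
    and minimizer: "is_arg_min f (\<lambda>z. z \<in> UNIV) xstar"
    and nu: "\<nu> = exp (- \<nu>)"
    and iterates: "\<And>k. x (Suc k) = gdps_step f xstar (x k)"
  shows "(\<forall>k. norm (grad f (x k)) \<ge> L0 / L1 \<longrightarrow>
            (norm (x (k + 1) - xstar))\<^sup>2 \<le> (norm (x k - xstar))\<^sup>2 - \<nu>\<^sup>2 / (16 * L1\<^sup>2))
       \<and> (\<forall>N :: nat.
            let \<T> = large_grad_steps L0 L1 f x N; T = real (card \<T>) in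
              4 * L0 / \<nu> * (norm (x (N + 1) - xstar))\<^sup>2
                + (\<Sum>k \<in> {0..N} - \<T>. f (x k) - f xstar)
                \<le> 4 * L0 / \<nu> * (norm (x 0 - xstar))\<^sup>2 - \<nu> * L0 * T / (4 * L1\<^sup>2)
            \<and> (real N > T - 1 \<longrightarrow>
                (\<forall>xhat. xhat \<in> x ` {0..N} \<and> f xhat = Min (f ` x ` {0..N}) \<longrightarrow>
                  f xhat - f xstar \<le>
                    4 * L0 * (norm (x 0 - xstar))\<^sup>2 / (\<nu> * (real N - T + 1))
                    - \<nu> * L0 * T / (4 * L1\<^sup>2 * (real N - T + 1))))
            \<and> (real N > 16 * L1\<^sup>2 * (norm (x 0 - xstar))\<^sup>2 / \<nu>\<^sup>2 - 1 \<longrightarrow>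
                real N > T - 1
                \<and> (\<forall>xhat. xhat \<in> x ` {0..N} \<and> f xhat = Min (f ` x ` {0..N}) \<longrightarrow>
                    f xhat - f xstar \<le>
                      4 * L0 * (norm (x 0 - xstar))\<^sup>2 / (\<nu> * (real N + 1)))))"
proof -
  interpret convex_L0_L1_smooth f L0 L1
    using diff conv smooth L0_pos L1_pos by unfold_locales
  have min: "f xstar \<le> f z" for z
    using minimizer by (auto simp: is_arg_min_linorder)
  have nu0: "\<nu> > 0"
    using nu exp_gt_zero[of "- \<nu>"] by linarith
  define R where "R = (norm (x 0 - xstar))\<^sup>2"
  have best: "f xhat \<le> f (x k)" if "f xhat = Min (f ` x ` {0..N})" "k \<le> N" for xhat k N
    using that by simp
  have rate: "f xhat - f xstar \<le> 4 * L0 * R / (\<nu> * (real N - T + 1))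
        - \<nu> * L0 * T / (4 * L1\<^sup>2 * (real N - T + 1))"
    if "T = real (card (large_grad_steps L0 L1 f x N))" "T < real N + 1"
      and "f xhat = Min (f ` x ` {0..N})" for xhat T N
    using gdps_best_iterate[where x = x, OF nu min iterates that(1,2) best[OF that(3)]]
    by (simp add: R_def diff_divide_distrib)
  have T_less: "real (card (large_grad_steps L0 L1 f x N)) < real N + 1"
    if "real N > 16 * L1\<^sup>2 * R / \<nu>\<^sup>2 - 1" for N
    using card_large_grad_steps_le[where x = x, OF nu min iterates, of N] that unfolding R_def by linarith
  have final: "f xhat - f xstar \<le> 4 * L0 * R / (\<nu> * (real N + 1))"
    if N: "real N > 16 * L1\<^sup>2 * R / \<nu>\<^sup>2 - 1"
      and xhat: "f xhat = Min (f ` x ` {0..N})" for xhat N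
  proof -
    define T where "T = real (card (large_grad_steps L0 L1 f x N))"
    have T: "0 \<le> T" "T < real N + 1"
      using T_less[OF N] by (simp_all add: T_def)
    \<comment> \<open>The rate reads \<open>(K * R - a * T) / (real N - T + 1)\<close>. It does not
      increase with \<open>T\<close> once \<open>K * R \<le> a * (real N + 1)\<close>, which is the
      assumption on \<open>N\<close> multiplied by \<open>a\<close>; hence the value at
      \<open>T = 0\<close> is an upper bound.\<close>
    define K where "K = 4 * L0 / \<nu>"
    define a where "a = \<nu> * L0 / (4 * L1\<^sup>2)"
    have "16 * L1\<^sup>2 * R / \<nu>\<^sup>2 \<le> real N + 1"
      using N by linarith
    then have "a * (16 * L1\<^sup>2 * R / \<nu>\<^sup>2) \<le> a * (real N + 1)"
      using nu0 L0_pos by (intro mult_left_mono) (auto simp: a_def)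
    moreover have "a * (16 * L1\<^sup>2 * R / \<nu>\<^sup>2) = K * R"
      using nu0 L1_pos by (simp add: K_def a_def power2_eq_square)
    ultimately have "K * R \<le> a * (real N + 1)"
      by simp
    then have "T * (K * R) \<le> T * (a * (real N + 1))"
      using T by (intro mult_left_mono)
    then have "(K * R - a * T) * (real N + 1) \<le> K * R * (real N - T + 1)"
      by (simp add: algebra_simps)
    then have "(K * R - a * T) / (real N - T + 1) \<le> K * R / (real N + 1)"
      using T by (simp add: field_simps)
    moreover have "f xhat - f xstar \<le> (K * R - a * T) / (real N - T + 1)"
      using gdps_best_iterate[where x = x, OF nu min iterates T_def T(2) best[OF xhat]]
      by (simp add: K_def a_def R_def)
    ultimately show ?thesis
      by (simp add: K_def)
  qed
  show ?thesis
    unfolding Let_def R_def[symmetric]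
  proof (intro conjI allI impI)
    fix k assume "L0 / L1 \<le> norm (grad f (x k))"
    then show "(norm (x (k + 1) - xstar))\<^sup>2 \<le> (norm (x k - xstar))\<^sup>2 - \<nu>\<^sup>2 / (16 * L1\<^sup>2)"
      using gdps_step_large_grad[OF nu min] by (simp add: iterates)
  qed (use gdps_sum[where x = x, OF nu min iterates, folded R_def] rate T_less final in
      \<open>auto simp: less_diff_eq diff_less_eq\<close>)
qed

end
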